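(* Let $(W,S)$ be a Coxeter system of finite rank with set of reflections $T$, let $w\in W$, let $w=s_1\cdots s_m$ be a reduced factorization of $w$ in simple reflections (that is, $s_i\in S$ and $m=\ell_S(w)$), and let $(t_1,\dots,t_n)\in T^n$ be a reduced reflection factorization of $w$. Then there exist $q_1,\dots,q_{m-n}\in S$ and a braid $\sigma\in\mathcal{B}_m$ such that $$\sigma(s_1,\dots,s_m)=(q_1,\dots,q_{m-n},t_1,\dots,t_n).$$
   Context: For a Coxeter system $(W,S)$, $T=\{wsw^{-1}\mid w\in W,\ s\in S\}$ is its set of reflections; its rank is $|S|$. $\ell_S(w)$ is the word length of $w$ with respect to $S$. The reflection length $\ell_T(w)$ is the smallest $n$ such that $w$ is a product of $n$ elements of $T$. A reduced reflection factorization of $w$ is a tuple $(t_1,\dots,t_n)\in T^n$ with $w=t_1\cdots t_n$ and $n=\ell_T(w)$. The braid group on $m$ strands $\mathcal{B}_m=\langle \sigma_1,\dots,\sigma_{m-1}\mid \sigma_i\sigma_{i+1}\sigma_i=\sigma_{i+1}\sigma_i\sigma_{i+1},\ \sigma_i\sigma_j=\sigma_j\sigma_i\ (|i-j|>1)\rangle$ acts on $T^m$ (Hurwitz action) by $$\sigma_i(t_1,\dots,t_m)=(t_1,\dots,t_{i-1},t_it_{i+1}t_i,t_i,t_{i+2},\dots,t_m),$$ $$\sigma_i^{-1}(t_1,\dots,t_m)=(t_1,\dots,t_{i-1},t_{i+1},t_{i+1}t_it_{i+1},t_{i+2},\dots,t_m).$$ *)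

theory Defs
  imports "HOL-Algebra.Group_Action" "HOL-Library.Extended_Nat"
begin

section \<open>Groups given by generators and relators\<close>

text \<open>The letter \<open>(x, True)\<close> stands for the generator \<open>x\<close>, and \<open>(x, False)\<close> for its formal inverse.\<close>

type_synonym 'g signed_word = "('g \<times> bool) list"

abbreviation signed_words :: "'g set \<Rightarrow> 'g signed_word set" where
  "signed_words X \<equiv> lists (X \<times> UNIV)"

definition positive_word :: "'g list \<Rightarrow> 'g signed_word" where
  "positive_word xs = map (\<lambda>x. (x, True)) xs"

definition inverse_word :: "'g signed_word \<Rightarrow> 'g signed_word" where
  "inverse_word u = rev (map (\<lambda>(x, b). (x, \<not> b)) u)"

inductive word_equiv :: "'g set \<Rightarrow> 'g signed_word set \<Rightarrow> 'g signed_word \<Rightarrow> 'g signed_word \<Rightarrow> bool"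
  for X :: "'g set" and R :: "'g signed_word set"
where
  word_refl: "u \<in> signed_words X \<Longrightarrow> word_equiv X R u u"
| word_sym: "word_equiv X R u v \<Longrightarrow> word_equiv X R v u"
| word_trans: "word_equiv X R u v \<Longrightarrow> word_equiv X R v w \<Longrightarrow> word_equiv X R u w"
| word_cancel: "u \<in> signed_words X \<Longrightarrow> v \<in> signed_words X \<Longrightarrow> x \<in> X \<Longrightarrow>
    word_equiv X R (u @ [(x, b), (x, \<not> b)] @ v) (u @ v)"
| word_relator: "u \<in> signed_words X \<Longrightarrow> v \<in> signed_words X \<Longrightarrow> r \<in> signed_words X \<Longrightarrow> r \<in> R \<Longrightarrow>
    word_equiv X R (u @ r @ v) (u @ v)"

definition word_class :: "'g set \<Rightarrow> 'g signed_word set \<Rightarrow> 'g signed_word \<Rightarrow> 'g signed_word set" where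
  "word_class X R u = {v. word_equiv X R u v}"

definition presented_group :: "'g set \<Rightarrow> 'g signed_word set \<Rightarrow> 'g signed_word set monoid" where
  "presented_group X R =
    \<lparr> carrier = word_class X R ` signed_words X,
      monoid.mult = (\<lambda>A B. {w. \<exists>u\<in>A. \<exists>v\<in>B. word_equiv X R (u @ v) w}),
      one = word_class X R [] \<rparr>"

section \<open>Coxeter systems\<close>

text \<open>\<open>M s t = \<infinity>\<close> means that there is no relator for the pair \<open>s, t\<close>. The relator for \<open>s = t\<close> is the
  word \<open>s s\<close>, since \<open>M s s = 1\<close>.\<close>

definition coxeter_matrix :: "'s set \<Rightarrow> ('s \<Rightarrow> 's \<Rightarrow> enat) \<Rightarrow> bool" where
  "coxeter_matrix S M \<longleftrightarrow>
    (\<forall>s\<in>S. \<forall>t\<in>S. M s t = M t s \<and> M s t \<ge> 1 \<and> (M s t = 1 \<longleftrightarrow> s = t))"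

definition coxeter_relators :: "'s set \<Rightarrow> ('s \<Rightarrow> 's \<Rightarrow> enat) \<Rightarrow> 's signed_word set" where
  "coxeter_relators S M =
    {positive_word (concat (replicate k [s, t])) | s t k. s \<in> S \<and> t \<in> S \<and> M s t = enat k}"

definition coxeter_system :: "('a, 'b) monoid_scheme \<Rightarrow> 'a set \<Rightarrow> bool" where
  "coxeter_system W S \<longleftrightarrow> group W \<and> S \<subseteq> carrier W \<and>
    (\<exists>M. coxeter_matrix S M \<and>
      (\<exists>\<phi> \<in> iso (presented_group S (coxeter_relators S M)) W.
        \<forall>s\<in>S. \<phi> (word_class S (coxeter_relators S M) (positive_word [s])) = s))"

definition reflections :: "('a, 'b) monoid_scheme \<Rightarrow> 'a set \<Rightarrow> 'a set" where
  "reflections W S = {w \<otimes>\<^bsub>W\<^esub> s \<otimes>\<^bsub>W\<^esub> inv\<^bsub>W\<^esub> w | w s. w \<in> carrier W \<and> s \<in> S}"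

definition list_product :: "('a, 'b) monoid_scheme \<Rightarrow> 'a list \<Rightarrow> 'a" where
  "list_product G xs = foldr (\<otimes>\<^bsub>G\<^esub>) xs \<one>\<^bsub>G\<^esub>"

text \<open>In the word length no inverses of elements of \<open>A\<close> are allowed. It is used only for sets \<open>A\<close> of
  involutions generating the group; \<open>\<ell>\<^sub>S\<close> is \<open>word_length W S\<close> and \<open>\<ell>\<^sub>T\<close> is
  \<open>word_length W (reflections W S)\<close>.\<close>

definition word_length :: "('a, 'b) monoid_scheme \<Rightarrow> 'a set \<Rightarrow> 'a \<Rightarrow> nat" where
  "word_length G A w = (LEAST n. \<exists>xs. length xs = n \<and> set xs \<subseteq> A \<and> list_product G xs = w)"

definition reduced_factorization :: "('a, 'b) monoid_scheme \<Rightarrow> 'a set \<Rightarrow> 'a \<Rightarrow> 'a list \<Rightarrow> bool" where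
  "reduced_factorization G A w xs \<longleftrightarrow>
    set xs \<subseteq> A \<and> list_product G xs = w \<and> length xs = word_length G A w"

section \<open>The braid group and the Hurwitz action\<close>

definition braid_relators :: "nat \<Rightarrow> nat signed_word set" where
  "braid_relators m =
    {positive_word [i, i + 1, i] @ inverse_word (positive_word [i + 1, i, i + 1]) | i.
       1 \<le> i \<and> i + 1 < m} \<union>
    {positive_word [i, j] @ inverse_word (positive_word [j, i]) | i j.
       i \<in> {1..<m} \<and> j \<in> {1..<m} \<and> \<bar>int i - int j\<bar> > 1}"

definition braid_group :: "nat \<Rightarrow> nat signed_word set monoid" where
  "braid_group m = presented_group {1..<m} (braid_relators m)"

text \<open>The generators are numbered from 1, whereas list positions are numbered from 0.\<close>

fun hurwitz_letter :: "('a, 'b) monoid_scheme \<Rightarrow> nat \<times> bool \<Rightarrow> 'a list \<Rightarrow> 'a list" where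
  "hurwitz_letter W (i, True) ts =
     ts[i - 1 := ts ! (i - 1) \<otimes>\<^bsub>W\<^esub> ts ! i \<otimes>\<^bsub>W\<^esub> ts ! (i - 1), i := ts ! (i - 1)]"
| "hurwitz_letter W (i, False) ts =
     ts[i - 1 := ts ! i, i := ts ! i \<otimes>\<^bsub>W\<^esub> ts ! (i - 1) \<otimes>\<^bsub>W\<^esub> ts ! i]"

definition hurwitz_word :: "('a, 'b) monoid_scheme \<Rightarrow> nat signed_word \<Rightarrow> 'a list \<Rightarrow> 'a list" where
  "hurwitz_word W u ts = foldr (hurwitz_letter W) u ts"

text \<open>For tuples of reflections the choice of the representing word is irrelevant; this is shown below
  (\<open>hurwitz_word_class\<close>), together with the fact that one obtains a group action
  (\<open>hurwitz_group_action\<close>).\<close>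

definition hurwitz :: "('a, 'b) monoid_scheme \<Rightarrow> nat signed_word set \<Rightarrow> 'a list \<Rightarrow> 'a list" where
  "hurwitz W \<sigma> ts = (THE ts'. \<exists>u\<in>\<sigma>. ts' = hurwitz_word W u ts)"

definition tuples :: "nat \<Rightarrow> 'a set \<Rightarrow> 'a list set" where
  "tuples m A = {xs. length xs = m \<and> set xs \<subseteq> A}"

section \<open>Well-definedness\<close>

lemma word_equiv_words:
  "word_equiv X R u v \<Longrightarrow> u \<in> signed_words X \<and> v \<in> signed_words X"
  by (induction rule: word_equiv.induct) auto

lemma word_equiv_context:
  assumes "word_equiv X R u v" "a \<in> signed_words X" "b \<in> signed_words X"
  shows "word_equiv X R (a @ u @ b) (a @ v @ b)"
  using assms
proof (induction rule: word_equiv.induct)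
  case (word_refl u)
  then show ?case by (intro word_equiv.word_refl) auto
next
  case (word_sym u v)
  then show ?case by (blast intro: word_equiv.word_sym)
next
  case (word_trans u v w)
  then show ?case by (blast intro: word_equiv.word_trans)
next
  case (word_cancel u v x c)
  have "word_equiv X R ((a @ u) @ [(x, c), (x, \<not> c)] @ (v @ b)) ((a @ u) @ (v @ b))"
    using word_cancel by (intro word_equiv.word_cancel) auto
  then show ?case by simp
next
  case (word_relator u v r)
  have "word_equiv X R ((a @ u) @ r @ (v @ b)) ((a @ u) @ (v @ b))"
    using word_relator by (intro word_equiv.word_relator) auto
  then show ?case by simp
qed

lemma word_equiv_append:
  assumes "word_equiv X R u u'" "word_equiv X R v v'"
  shows "word_equiv X R (u @ v) (u' @ v')"
proof -
  have "word_equiv X R ([] @ u @ v) ([] @ u' @ v)"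
    using assms word_equiv_words by (intro word_equiv_context) blast+
  moreover have "word_equiv X R (u' @ v @ []) (u' @ v' @ [])"
    using assms word_equiv_words by (intro word_equiv_context) blast+
  ultimately show ?thesis by (auto intro: word_trans)
qed

lemma inverse_word_words: "u \<in> signed_words X \<Longrightarrow> inverse_word u \<in> signed_words X"
  by (induction u) (auto simp: inverse_word_def)

lemma inverse_word_equiv:
  "u \<in> signed_words X \<Longrightarrow> word_equiv X R (inverse_word u @ u) []"
proof (induction u)
  case Nil
  then show ?case by (auto simp: inverse_word_def intro: word_refl)
next
  case (Cons l u)
  obtain x b where l: "l = (x, b)" by (cases l)
  have "word_equiv X R (inverse_word u @ [(x, \<not> b), (x, \<not> \<not> b)] @ u) (inverse_word u @ u)"
    using Cons l by (intro word_cancel inverse_word_words) auto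
  then show ?case
    using Cons l by (auto simp: inverse_word_def intro: word_trans)
qed

lemma word_class_eq_iff:
  assumes "u \<in> signed_words X"
  shows "word_class X R u = word_class X R v \<longleftrightarrow> word_equiv X R u v"
  using assms unfolding word_class_def by (blast intro: word_refl word_sym word_trans)

lemma presented_group_simps:
  "carrier (presented_group X R) = word_class X R ` signed_words X"
  "\<one>\<^bsub>presented_group X R\<^esub> = word_class X R []"
  by (simp_all add: presented_group_def)

lemma presented_group_mult:
  assumes "u \<in> signed_words X" "v \<in> signed_words X"
  shows "word_class X R u \<otimes>\<^bsub>presented_group X R\<^esub> word_class X R v = word_class X R (u @ v)"
  using assms unfolding presented_group_def word_class_def
  by (auto intro: word_refl word_sym word_trans word_equiv_append)

lemma presented_group_is_group: "group (presented_group X R)"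
proof (rule groupI)
  fix A assume "A \<in> carrier (presented_group X R)"
  then obtain u where u: "u \<in> signed_words X" "A = word_class X R u"
    by (auto simp: presented_group_simps)
  have "word_class X R (inverse_word u) \<otimes>\<^bsub>presented_group X R\<^esub> A = \<one>\<^bsub>presented_group X R\<^esub>"
    using u inverse_word_words[OF u(1)] inverse_word_equiv[OF u(1)]
    by (simp add: presented_group_mult presented_group_simps word_class_eq_iff)
  then show "\<exists>B\<in>carrier (presented_group X R).
      B \<otimes>\<^bsub>presented_group X R\<^esub> A = \<one>\<^bsub>presented_group X R\<^esub>"
    using inverse_word_words[OF u(1)] by (auto simp: presented_group_simps)
next
  show "\<one>\<^bsub>presented_group X R\<^esub> \<in> carrier (presented_group X R)"
    by (auto simp: presented_group_simps)
next
  fix A B assume "A \<in> carrier (presented_group X R)" "B \<in> carrier (presented_group X R)"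
  then obtain u v where "u \<in> signed_words X" "A = word_class X R u"
    "v \<in> signed_words X" "B = word_class X R v"
    by (auto simp: presented_group_simps)
  then show "A \<otimes>\<^bsub>presented_group X R\<^esub> B \<in> carrier (presented_group X R)"
    by (simp add: presented_group_mult) (simp add: presented_group_simps)
next
  fix A B C assume "A \<in> carrier (presented_group X R)" "B \<in> carrier (presented_group X R)"
    "C \<in> carrier (presented_group X R)"
  then obtain u v w where "u \<in> signed_words X" "A = word_class X R u"
    "v \<in> signed_words X" "B = word_class X R v" "w \<in> signed_words X" "C = word_class X R w"
    by (auto simp: presented_group_simps)
  then show "A \<otimes>\<^bsub>presented_group X R\<^esub> B \<otimes>\<^bsub>presented_group X R\<^esub> C =
      A \<otimes>\<^bsub>presented_group X R\<^esub> (B \<otimes>\<^bsub>presented_group X R\<^esub> C)"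
    by (simp add: presented_group_mult)
next
  fix A assume "A \<in> carrier (presented_group X R)"
  then obtain u where "u \<in> signed_words X" "A = word_class X R u"
    by (auto simp: presented_group_simps)
  then show "\<one>\<^bsub>presented_group X R\<^esub> \<otimes>\<^bsub>presented_group X R\<^esub> A = A"
    using presented_group_mult[of "[]" X u R] by (simp add: presented_group_simps)
qed

lemma coxeter_system_involution:
  assumes "coxeter_system W S" "s \<in> S"
  shows "s \<otimes>\<^bsub>W\<^esub> s = \<one>\<^bsub>W\<^esub>"
proof -
  interpret group W using assms by (simp add: coxeter_system_def)
  obtain M \<phi> where M: "coxeter_matrix S M"
    and \<phi>: "\<phi> \<in> iso (presented_group S (coxeter_relators S M)) W"
      "\<phi> (word_class S (coxeter_relators S M) (positive_word [s])) = s"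
    using assms unfolding coxeter_system_def by blast
  let ?R = "coxeter_relators S M"
  let ?P = "presented_group S ?R"
  let ?c = "word_class S ?R (positive_word [s])"
  interpret h: group_hom ?P W \<phi>
    using \<phi> presented_group_is_group
    by (auto simp: group_hom_def group_hom_axioms_def iso_def)
  have "M s s = enat 1" using M assms(2) by (simp add: coxeter_matrix_def one_enat_def)
  then have "positive_word (concat (replicate 1 [s, s])) \<in> ?R"
    using assms(2) unfolding coxeter_relators_def by blast
  then have "word_equiv S ?R ([] @ positive_word [s, s] @ []) ([] @ [])"
    using assms(2) by (intro word_relator) (auto simp: positive_word_def)
  then have "?c \<otimes>\<^bsub>?P\<^esub> ?c = \<one>\<^bsub>?P\<^esub>"
    using assms(2)
    by (simp add: presented_group_mult presented_group_simps positive_word_def word_class_eq_iff)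
  moreover have "?c \<in> carrier ?P"
    using assms(2) by (auto simp: presented_group_simps positive_word_def)
  ultimately show ?thesis using \<phi>(2) h.hom_mult h.hom_one by metis
qed

text \<open>The properties of the set of reflections that make the Hurwitz action well-defined.\<close>

locale involution_class = group W for W (structure) +
  fixes T
  assumes T_carrier: "T \<subseteq> carrier W"
    and T_involution: "t \<in> T \<Longrightarrow> t \<otimes> t = \<one>"
    and T_conj: "s \<in> T \<Longrightarrow> t \<in> T \<Longrightarrow> s \<otimes> t \<otimes> s \<in> T"

lemma reflections_involution_class:
  assumes "coxeter_system W S"
  shows "involution_class W (reflections W S)"
proof -
  interpret group W using assms by (simp add: coxeter_system_def)
  have S: "S \<subseteq> carrier W" using assms by (simp add: coxeter_system_def)
  show ?thesis
  proof
    show "reflections W S \<subseteq> carrier W" using S by (auto simp: reflections_def)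
  next
    fix t assume "t \<in> reflections W S"
    then obtain w s where ws: "w \<in> carrier W" "s \<in> S" "t = w \<otimes>\<^bsub>W\<^esub> s \<otimes>\<^bsub>W\<^esub> inv\<^bsub>W\<^esub> w"
      by (auto simp: reflections_def)
    have s: "s \<in> carrier W" using ws S by auto
    have "t \<otimes>\<^bsub>W\<^esub> t = w \<otimes>\<^bsub>W\<^esub> (s \<otimes>\<^bsub>W\<^esub> s) \<otimes>\<^bsub>W\<^esub> inv\<^bsub>W\<^esub> w"
      using ws s by (simp add: m_assoc) (simp flip: m_assoc)
    then show "t \<otimes>\<^bsub>W\<^esub> t = \<one>\<^bsub>W\<^esub>"
      using ws s coxeter_system_involution[OF assms ws(2)] by simp
  next
    fix t t' assume t: "t \<in> reflections W S" "t' \<in> reflections W S"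
    obtain w s where ws: "w \<in> carrier W" "s \<in> S" "t = w \<otimes>\<^bsub>W\<^esub> s \<otimes>\<^bsub>W\<^esub> inv\<^bsub>W\<^esub> w"
      using t by (auto simp: reflections_def)
    obtain w' s' where ws': "w' \<in> carrier W" "s' \<in> S" "t' = w' \<otimes>\<^bsub>W\<^esub> s' \<otimes>\<^bsub>W\<^esub> inv\<^bsub>W\<^esub> w'"
      using t by (auto simp: reflections_def)
    have s: "s \<in> carrier W" "s' \<in> carrier W" using ws ws' S by auto
    have "inv\<^bsub>W\<^esub> s = s" using coxeter_system_involution[OF assms ws(2)] s inv_equality by blast
    then have it: "inv\<^bsub>W\<^esub> t = t" using ws s by (simp add: inv_mult_group m_assoc)
    have tc: "t \<in> carrier W" using ws s by simp
    have "t \<otimes>\<^bsub>W\<^esub> t' \<otimes>\<^bsub>W\<^esub> inv\<^bsub>W\<^esub> t = (t \<otimes>\<^bsub>W\<^esub> w') \<otimes>\<^bsub>W\<^esub> s' \<otimes>\<^bsub>W\<^esub> inv\<^bsub>W\<^esub> (t \<otimes>\<^bsub>W\<^esub> w')"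
      using ws' s tc by (simp add: inv_mult_group m_assoc)
    then show "t \<otimes>\<^bsub>W\<^esub> t' \<otimes>\<^bsub>W\<^esub> t \<in> reflections W S"
      using it tc ws' by (auto simp: reflections_def)
  qed
qed

context involution_class
begin

lemma T_closed [simp]: "t \<in> T \<Longrightarrow> t \<in> carrier W"
  using T_carrier by blast

lemma T_cancel: "t \<in> T \<Longrightarrow> x \<in> carrier W \<Longrightarrow> t \<otimes> (t \<otimes> x) = x"
  by (metis T_closed T_involution l_one m_assoc)

lemma tuples_nth: "ts \<in> tuples m T \<Longrightarrow> k < m \<Longrightarrow> ts ! k \<in> T"
  by (auto simp: tuples_def)

lemma hurwitz_letter_tuples:
  assumes "ts \<in> tuples m T" "i \<in> {1..<m}"
  shows "hurwitz_letter W (i, b) ts \<in> tuples m T"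
proof -
  have T: "ts ! i \<in> T" "ts ! (i - 1) \<in> T" using assms tuples_nth by auto
  have "length ts = m" "set ts \<subseteq> T" using assms by (auto simp: tuples_def)
  then show ?thesis
    using T T_conj by (cases b) (simp_all add: tuples_def set_update_subsetI)
qed

lemma hurwitz_word_tuples:
  "ts \<in> tuples m T \<Longrightarrow> u \<in> signed_words {1..<m} \<Longrightarrow> hurwitz_word W u ts \<in> tuples m T"
  by (induction u) (auto simp: hurwitz_word_def intro!: hurwitz_letter_tuples)

lemma hurwitz_word_append: "hurwitz_word W (u @ v) ts = hurwitz_word W u (hurwitz_word W v ts)"
  by (simp add: hurwitz_word_def)

lemma hurwitz_cancel:
  assumes "ts \<in> tuples m T" "i \<in> {1..<m}"
  shows "hurwitz_letter W (i, b) (hurwitz_letter W (i, \<not> b) ts) = ts"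
proof -
  have T: "ts ! i \<in> T" "ts ! (i - 1) \<in> T" using assms tuples_nth by auto
  have "length ts = m" using assms by (auto simp: tuples_def)
  then show ?thesis
    using T assms(2)
    by (cases b) (auto simp: m_assoc T_cancel T_involution nth_list_update intro!: nth_equalityI)
qed

lemma hurwitz_inverse_word:
  assumes "ts \<in> tuples m T" "u \<in> signed_words {1..<m}"
  shows "hurwitz_word W u (hurwitz_word W (inverse_word u) ts) = ts"
  using assms
proof (induction u arbitrary: ts)
  case Nil
  then show ?case by (simp add: hurwitz_word_def inverse_word_def)
next
  case (Cons l u)
  obtain i b where l: "l = (i, b)" by (cases l)
  have i: "i \<in> {1..<m}" and u: "u \<in> signed_words {1..<m}" using Cons.prems l by auto
  have "inverse_word (l # u) = inverse_word u @ [(i, \<not> b)]" by (simp add: inverse_word_def l)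
  then have "hurwitz_word W (l # u) (hurwitz_word W (inverse_word (l # u)) ts) =
      hurwitz_letter W (i, b) (hurwitz_word W u (hurwitz_word W (inverse_word u)
        (hurwitz_letter W (i, \<not> b) ts)))"
    by (simp add: hurwitz_word_append l) (simp add: hurwitz_word_def)
  also have "\<dots> = hurwitz_letter W (i, b) (hurwitz_letter W (i, \<not> b) ts)"
    using Cons.IH[OF hurwitz_letter_tuples[OF Cons.prems(1) i] u] by simp
  finally show ?case using hurwitz_cancel[OF Cons.prems(1) i] by simp
qed

lemma hurwitz_relation:
  assumes "ts \<in> tuples m T" "u \<in> signed_words {1..<m}" "v \<in> signed_words {1..<m}"
    and "\<And>ts. ts \<in> tuples m T \<Longrightarrow> hurwitz_word W u ts = hurwitz_word W v ts"
  shows "hurwitz_word W (u @ inverse_word v) ts = ts"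
proof -
  have "hurwitz_word W (inverse_word v) ts \<in> tuples m T"
    using assms(1,3) by (intro hurwitz_word_tuples inverse_word_words)
  then show ?thesis
    using hurwitz_inverse_word[OF assms(1,3)] assms(4) by (simp add: hurwitz_word_append)
qed

lemma hurwitz_braid:
  assumes "ts \<in> tuples m T" "1 \<le> i" "i + 1 < m"
  shows "hurwitz_word W (positive_word [i, i + 1, i]) ts =
    hurwitz_word W (positive_word [i + 1, i, i + 1]) ts"
proof -
  obtain k where k: "i = Suc k" using assms(2) by (cases i) auto
  have T: "ts ! k \<in> T" "ts ! Suc k \<in> T" "ts ! Suc (Suc k) \<in> T" using assms k tuples_nth by auto
  have "length ts = m" using assms by (auto simp: tuples_def)
  then show ?thesis
    using T assms(3) k
    by (auto simp: hurwitz_word_def positive_word_def m_assoc T_cancel T_involution nth_list_update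
        intro!: nth_equalityI)
qed

lemma hurwitz_commute:
  assumes "ts \<in> tuples m T" "i \<in> {1..<m}" "j \<in> {1..<m}" "\<bar>int i - int j\<bar> > 1"
  shows "hurwitz_word W (positive_word [i, j]) ts = hurwitz_word W (positive_word [j, i]) ts"
proof -
  obtain k where k: "i = Suc k" using assms(2) by (cases i) auto
  obtain l where l: "j = Suc l" using assms(3) by (cases j) auto
  have d: "k \<noteq> l" "k \<noteq> Suc l" "l \<noteq> Suc k" using assms(4) k l by auto
  have "length ts = m" using assms by (auto simp: tuples_def)
  then show ?thesis
    using d assms(2,3) k l
    by (auto simp: hurwitz_word_def positive_word_def nth_list_update intro!: nth_equalityI)
qed

lemma hurwitz_braid_relator:
  assumes "ts \<in> tuples m T" "r \<in> braid_relators m"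
  shows "hurwitz_word W r ts = ts"
proof -
  from assms(2) consider
      i where "1 \<le> i" "i + 1 < m"
        "r = positive_word [i, i + 1, i] @ inverse_word (positive_word [i + 1, i, i + 1])"
    | i j where "i \<in> {1..<m}" "j \<in> {1..<m}" "\<bar>int i - int j\<bar> > 1"
        "r = positive_word [i, j] @ inverse_word (positive_word [j, i])"
    unfolding braid_relators_def by blast
  then show ?thesis
  proof cases
    case 1
    show ?thesis unfolding 1(3)
      by (rule hurwitz_relation[OF assms(1)])
        (use 1 hurwitz_braid in \<open>auto simp: positive_word_def\<close>)
  next
    case 2
    show ?thesis unfolding 2(4)
      by (rule hurwitz_relation[OF assms(1)])
        (use 2 hurwitz_commute in \<open>auto simp: positive_word_def\<close>)
  qed
qed

lemma hurwitz_word_equiv: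
  assumes "word_equiv {1..<m} (braid_relators m) u v" "ts \<in> tuples m T"
  shows "hurwitz_word W u ts = hurwitz_word W v ts"
  using assms
proof (induction arbitrary: ts rule: word_equiv.induct)
  case (word_cancel u v x b)
  have "hurwitz_word W v ts \<in> tuples m T" using word_cancel hurwitz_word_tuples by blast
  then have "hurwitz_word W [(x, b), (x, \<not> b)] (hurwitz_word W v ts) = hurwitz_word W v ts"
    using hurwitz_cancel word_cancel by (simp add: hurwitz_word_def)
  then show ?case by (simp only: hurwitz_word_append)
next
  case (word_relator u v r)
  have "hurwitz_word W v ts \<in> tuples m T" using word_relator hurwitz_word_tuples by blast
  then show ?case
    using hurwitz_braid_relator word_relator by (simp add: hurwitz_word_append)
qed auto

lemma hurwitz_class:
  assumes "ts \<in> tuples m T" "u \<in> signed_words {1..<m}"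
  shows "hurwitz W (word_class {1..<m} (braid_relators m) u) ts = hurwitz_word W u ts"
  unfolding hurwitz_def
proof (rule the_equality)
  show "\<exists>v\<in>word_class {1..<m} (braid_relators m) u. hurwitz_word W u ts = hurwitz_word W v ts"
    using assms(2) by (auto simp: word_class_def intro: word_refl)
  show "ts' = hurwitz_word W u ts"
    if "\<exists>v\<in>word_class {1..<m} (braid_relators m) u. ts' = hurwitz_word W v ts" for ts'
    using that hurwitz_word_equiv[OF _ assms(1)] by (force simp: word_class_def)
qed

lemma hurwitz_action:
  "group_action (braid_group m) (tuples m T) (\<lambda>\<sigma>. restrict (hurwitz W \<sigma>) (tuples m T))"
proof -
  let ?c = "word_class {1..<m} (braid_relators m)"
  let ?E = "tuples m T"
  have eq: "restrict (hurwitz W (?c u)) ?E = restrict (hurwitz_word W u) ?E"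
    if "u \<in> signed_words {1..<m}" for u
    using that hurwitz_class by (intro restrict_ext) auto
  have cancel: "hurwitz_word W (inverse_word u) (hurwitz_word W u ts) = ts"
    if "u \<in> signed_words {1..<m}" "ts \<in> ?E" for u ts
    using hurwitz_word_equiv[OF inverse_word_equiv[OF that(1)] that(2)]
    by (simp add: hurwitz_word_append) (simp add: hurwitz_word_def)
  have Bij: "restrict (hurwitz_word W u) ?E \<in> Bij ?E" if u: "u \<in> signed_words {1..<m}" for u
  proof -
    have "bij_betw (hurwitz_word W u) ?E ?E"
      by (rule bij_betwI[where g = "hurwitz_word W (inverse_word u)"])
        (use u cancel hurwitz_inverse_word hurwitz_word_tuples inverse_word_words in blast)+
    then show ?thesis by (simp add: Bij_def)
  qed
  have "(\<lambda>\<sigma>. restrict (hurwitz W \<sigma>) ?E) \<in> hom (braid_group m) (BijGroup ?E)"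
  proof (rule homI)
    fix \<sigma> assume "\<sigma> \<in> carrier (braid_group m)"
    then obtain u where "u \<in> signed_words {1..<m}" "\<sigma> = ?c u"
      by (auto simp: braid_group_def presented_group_simps)
    then show "restrict (hurwitz W \<sigma>) ?E \<in> carrier (BijGroup ?E)"
      using eq Bij by (simp add: BijGroup_def)
  next
    fix \<sigma> \<tau> assume "\<sigma> \<in> carrier (braid_group m)" "\<tau> \<in> carrier (braid_group m)"
    then obtain u v where uv: "u \<in> signed_words {1..<m}" "\<sigma> = ?c u"
      "v \<in> signed_words {1..<m}" "\<tau> = ?c v"
      by (auto simp: braid_group_def presented_group_simps)
    have "restrict (hurwitz_word W (u @ v)) ?E =
        compose ?E (restrict (hurwitz_word W u) ?E) (restrict (hurwitz_word W v) ?E)"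
      using hurwitz_word_tuples[OF _ uv(3)]
      by (intro ext) (simp add: compose_def restrict_def hurwitz_word_append)
    moreover have "u @ v \<in> signed_words {1..<m}" using uv by simp
    ultimately show "restrict (hurwitz W (\<sigma> \<otimes>\<^bsub>braid_group m\<^esub> \<tau>)) ?E =
        restrict (hurwitz W \<sigma>) ?E \<otimes>\<^bsub>BijGroup ?E\<^esub> restrict (hurwitz W \<tau>) ?E"
      using uv eq Bij by (simp add: braid_group_def presented_group_mult BijGroup_def)
  qed
  then show ?thesis
    using presented_group_is_group group_BijGroup
    by (auto simp: group_action_def group_hom_def group_hom_axioms_def braid_group_def)
qed

end

theorem hurwitz_word_class:
  assumes "coxeter_system W S" "ts \<in> tuples m (reflections W S)" "u \<in> signed_words {1..<m}"
  shows "hurwitz W (word_class {1..<m} (braid_relators m) u) ts = hurwitz_word W u ts"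
  using involution_class.hurwitz_class[OF reflections_involution_class[OF assms(1)] assms(2,3)] .

theorem hurwitz_group_action:
  assumes "coxeter_system W S"
  shows "group_action (braid_group m) (tuples m (reflections W S))
    (\<lambda>\<sigma>. restrict (hurwitz W \<sigma>) (tuples m (reflections W S)))"
  using involution_class.hurwitz_action[OF reflections_involution_class[OF assms]] .

end

theory Submission
  imports Defs
begin

text \<open>
  The idea is to peel reflections off the right end of the word. If \<open>t\<close> is a reflection with
  \<open>\<ell>\<^sub>S(wt) < \<ell>\<^sub>S(w)\<close> and \<open>s\<^sub>1 \<dots> s\<^sub>m\<close> is any word for \<open>w\<close>, reduced or not, then the strong exchange
  property says that deleting some letter \<open>s\<^sub>i\<close> turns it into a word for \<open>wt\<close>. Hurwitz moves carry
  \<open>s\<^sub>i\<close> to the right across the letters behind it, leaving these unchanged, and on arrival \<open>s\<^sub>i\<close> has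
  become \<open>s\<^sub>m \<dots> s\<^sub>i \<dots> s\<^sub>m = t\<close>. Hence if the partial products of \<open>(t\<^sub>1, \<dots>, t\<^sub>n)\<close> have strictly increasing
  length, then \<open>t\<^sub>n, t\<^sub>n\<^sub>-\<^sub>1, \<dots>, t\<^sub>1\<close> can be moved to the right end one after the other, and what remains in
  front of them is a subword of simple reflections (\<open>hurwitz_moves_ascending\<close>).

  It remains to see that every reduced reflection factorization lies in the Hurwitz orbit of one with
  increasing partial products (\<open>ascending_representative\<close>). The lengths of neighbouring partial products
  differ, so a sequence of partial products that starts at the identity and has no peak is
  increasing. A factorization in the orbit that minimizes the sum of the lengths of its partial
  products has no peak: at a peak \<open>a < ap > apq\<close>, Hurwitz moves on the two factors \<open>p, q\<close> alone
  replace the top \<open>ap\<close> by \<open>ap'\<close> for any reflection \<open>p' = (pq)\<^sup>k p\<close>, and for some \<open>k\<close> this is shorter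
  than \<open>ap\<close> (\<open>peak_lowering\<close>). Here \<open>p\<close> and \<open>q\<close> are distinct
  because the factorization is reduced.

  Both the exchange property and \<open>peak_lowering\<close> rest on the inversion sets
  \<open>N(w) = {t \<in> T. \<ell>\<^sub>S(wt) < \<ell>\<^sub>S(w)}\<close> and their cocycle rule, according to which \<open>N(xy)\<close> is the symmetric
  difference of \<open>y\<^sup>-\<^sup>1 N(x) y\<close> and \<open>N(y)\<close> (\<open>inversion_mult\<close>). A word determines the list of the
  reflections that delete one of its letters, and \<open>N(w)\<close> consists of those occurring an odd number of times;
  this parity depends only on \<open>w\<close>, because the defining relators of the group do not change it
  (\<open>occurs_oddly_well_defined\<close>).
\<close>

section \<open>Hurwitz moves\<close>

inductive hurwitz_move :: "('a, 'b) monoid_scheme \<Rightarrow> 'a list \<Rightarrow> 'a list \<Rightarrow> bool"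
  for G :: "('a, 'b) monoid_scheme"
where
  move_right: "hurwitz_move G (as @ a # b # bs) (as @ b # (b \<otimes>\<^bsub>G\<^esub> a \<otimes>\<^bsub>G\<^esub> b) # bs)"
| move_left: "hurwitz_move G (as @ a # b # bs) (as @ (a \<otimes>\<^bsub>G\<^esub> b \<otimes>\<^bsub>G\<^esub> a) # a # bs)"

lemma hurwitz_move_context:
  assumes "hurwitz_move G xs ys"
  shows "hurwitz_move G (as @ xs @ bs) (as @ ys @ bs)"
  using assms
proof cases
  case (move_right cs a b ds)
  then show ?thesis using hurwitz_move.move_right[of G "as @ cs" a b "ds @ bs"] by simp
next
  case (move_left cs a b ds)
  then show ?thesis using hurwitz_move.move_left[of G "as @ cs" a b "ds @ bs"] by simp
qed

lemma hurwitz_moves_context: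
  assumes "(hurwitz_move G)\<^sup>*\<^sup>* xs ys"
  shows "(hurwitz_move G)\<^sup>*\<^sup>* (as @ xs @ bs) (as @ ys @ bs)"
  using assms
  by (induction rule: rtranclp_induct) (auto intro: rtranclp.rtrancl_into_rtrancl hurwitz_move_context)

section \<open>The reflections that delete a letter\<close>

text \<open>
  Multiplying \<open>x\<^sub>1 \<dots> x\<^sub>n\<close> on the right by the \<open>i\<close>-th entry of the list deletes the letter \<open>x\<^sub>i\<close> when \<open>x\<^sub>i\<close>
  is an involution.
\<close>

primrec inversion_list :: "('a, 'b) monoid_scheme \<Rightarrow> 'a list \<Rightarrow> 'a list" where
  "inversion_list G [] = []"
| "inversion_list G (s # xs) =
    (inv\<^bsub>G\<^esub> (list_product G xs) \<otimes>\<^bsub>G\<^esub> s \<otimes>\<^bsub>G\<^esub> list_product G xs) # inversion_list G xs"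

context group
begin

lemma inv_mult_cancel: "x \<in> carrier G \<Longrightarrow> y \<in> carrier G \<Longrightarrow> inv x \<otimes> (x \<otimes> y) = y"
  by (simp flip: m_assoc)

lemma mult_inv_cancel: "x \<in> carrier G \<Longrightarrow> y \<in> carrier G \<Longrightarrow> x \<otimes> (inv x \<otimes> y) = y"
  by (simp flip: m_assoc)

lemma list_product_simps [simp]:
  "list_product G [] = \<one>"
  "list_product G (x # xs) = x \<otimes> list_product G xs"
  by (simp_all add: list_product_def)

lemma list_product_closed [simp]: "set xs \<subseteq> carrier G \<Longrightarrow> list_product G xs \<in> carrier G"
  by (induction xs) auto

lemma list_product_append:
  "set xs \<subseteq> carrier G \<Longrightarrow> set ys \<subseteq> carrier G \<Longrightarrow>
    list_product G (xs @ ys) = list_product G xs \<otimes> list_product G ys"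
  by (induction xs) (auto simp: m_assoc)

lemma inversion_list_closed: "set xs \<subseteq> carrier G \<Longrightarrow> set (inversion_list G xs) \<subseteq> carrier G"
  by (induction xs) auto

lemma inversion_list_append:
  assumes "set xs \<subseteq> carrier G" "set ys \<subseteq> carrier G"
  shows "inversion_list G (xs @ ys) =
    map (\<lambda>t. inv (list_product G ys) \<otimes> t \<otimes> list_product G ys) (inversion_list G xs) @
    inversion_list G ys"
  using assms
  by (induction xs) (auto simp: list_product_append inv_mult_group m_assoc)

lemma count_list_conj:
  assumes "set rs \<subseteq> carrier G" "y \<in> carrier G" "t \<in> carrier G"
  shows "count_list (map (\<lambda>r. inv y \<otimes> r \<otimes> y) rs) t = count_list rs (y \<otimes> t \<otimes> inv y)"
  using assms
proof (induction rs)
  case (Cons r rs)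
  then have r: "r \<in> carrier G" by simp
  have "inv y \<otimes> r \<otimes> y = t \<longleftrightarrow> r = y \<otimes> t \<otimes> inv y"
  proof
    assume "inv y \<otimes> r \<otimes> y = t"
    then show "r = y \<otimes> t \<otimes> inv y" using r assms(2) by (auto simp: m_assoc mult_inv_cancel)
  next
    assume "r = y \<otimes> t \<otimes> inv y"
    then show "inv y \<otimes> r \<otimes> y = t" using assms(2,3) by (simp add: m_assoc inv_mult_cancel)
  qed
  then show ?case using Cons by simp
qed simp

abbreviation occurs_oddly :: "'a list \<Rightarrow> 'a \<Rightarrow> bool" where
  "occurs_oddly xs t \<equiv> odd (count_list (inversion_list G xs) t)"

text \<open>
  The cocycle rule on the level of words: the letters of \<open>xs\<close> contribute their reflections conjugated by
  the product of \<open>ys\<close>.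
\<close>

lemma occurs_oddly_append:
  assumes "set xs \<subseteq> carrier G" "set ys \<subseteq> carrier G" "t \<in> carrier G"
  shows "occurs_oddly (xs @ ys) t \<longleftrightarrow>
    (occurs_oddly xs (list_product G ys \<otimes> t \<otimes> inv (list_product G ys)) \<noteq> occurs_oddly ys t)"
  using assms by (simp add: inversion_list_append count_list_conj inversion_list_closed)

text \<open>
  A word with product \<open>\<one>\<close> conjugates nothing, so inserting it into another word is invisible to the
  parities if its own reflections occur evenly. This is the form in which relators are used.
\<close>

lemma occurs_oddly_insert:
  assumes "set xs \<subseteq> carrier G" "set rs \<subseteq> carrier G" "set ys \<subseteq> carrier G" "t \<in> carrier G"
    and "list_product G rs = \<one>" "\<And>t. t \<in> carrier G \<Longrightarrow> \<not> occurs_oddly rs t"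
  shows "occurs_oddly (xs @ rs @ ys) t \<longleftrightarrow> occurs_oddly (xs @ ys) t"
  using assms by (simp add: occurs_oddly_append list_product_append)

lemma inversion_list_member:
  assumes "set xs \<subseteq> carrier G" "t \<in> set (inversion_list G xs)"
  shows "\<exists>as s bs. xs = as @ s # bs \<and> t = inv (list_product G bs) \<otimes> s \<otimes> list_product G bs"
  using assms
proof (induction xs)
  case (Cons x xs)
  show ?case
  proof (cases "t \<in> set (inversion_list G xs)")
    case True
    then obtain as s bs where "xs = as @ s # bs"
      "t = inv (list_product G bs) \<otimes> s \<otimes> list_product G bs" using Cons by auto
    then show ?thesis by (intro exI[of _ "x # as"]) auto
  next
    case False
    then show ?thesis using Cons by (intro exI[of _ "[]"]) auto
  qed
qed simp

text \<open>
  Read from the right, the letters of \<open>stst \<dots> st\<close> are deleted by \<open>t\<close>, \<open>tst\<close>, \<open>tstst\<close> and so on, the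
  palindromes \<open>(ts)\<^sup>j t\<close>.
\<close>

lemma inversion_list_dihedral:
  fixes s t :: 'a
  assumes s: "s \<in> carrier G" "s \<otimes> s = \<one>" and t: "t \<in> carrier G" "t \<otimes> t = \<one>"
  defines "z \<equiv> \<lambda>k. concat (replicate k [s, t])"
  shows "inversion_list G (z k) = rev (map (\<lambda>j. (t \<otimes> s) [^] j \<otimes> t) [0..<2 * k])"
    and "list_product G (z k) = (s \<otimes> t) [^] k"
proof -
  have inv: "inv s = s" "inv t = t" using s t inv_equality by blast+
  have zc: "set (z k) \<subseteq> carrier G" for k using s t by (auto simp: z_def)
  show zp: "list_product G (z k) = (s \<otimes> t) [^] k" for k
  proof (induction k)
    case (Suc k)
    have "list_product G (z (Suc k)) = (s \<otimes> t) \<otimes> (s \<otimes> t) [^] k"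
      using Suc s t by (simp add: z_def m_assoc)
    then show ?case using nat_pow_Suc2 s t by simp
  qed (simp add: z_def)
  have flip: "t \<otimes> (s \<otimes> t) [^] k = (t \<otimes> s) [^] k \<otimes> t" for k :: nat
  proof (induction k)
    case (Suc k)
    have "t \<otimes> (s \<otimes> t) [^] Suc k = (t \<otimes> (s \<otimes> t) [^] k) \<otimes> (s \<otimes> t)" using s t by (simp add: m_assoc)
    then show ?case using Suc s t by (simp add: m_assoc)
  qed (use s t in simp)
  have invp: "inv ((s \<otimes> t) [^] k) = (t \<otimes> s) [^] k" for k :: nat
  proof -
    have "t \<otimes> s = inv (s \<otimes> t)" using s t inv by (simp add: inv_mult_group)
    then show ?thesis using s t by (simp add: nat_pow_inv)
  qed
  show "inversion_list G (z k) = rev (map (\<lambda>j. (t \<otimes> s) [^] j \<otimes> t) [0..<2 * k])"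
  proof (induction k)
    case (Suc k)
    let ?p = "(s \<otimes> t) [^] k" and ?q = "(t \<otimes> s) [^] k"
    have z: "z (Suc k) = s # t # z k" by (simp add: z_def)
    have 1: "inv ?p \<otimes> t \<otimes> ?p = (t \<otimes> s) [^] (2 * k) \<otimes> t"
    proof -
      have "inv ?p \<otimes> t \<otimes> ?p = ?q \<otimes> (?q \<otimes> t)" using s t by (simp add: invp m_assoc flip)
      also have "\<dots> = (?q \<otimes> ?q) \<otimes> t" using s t by (simp add: m_assoc)
      finally show ?thesis using s t by (simp add: nat_pow_mult mult_2)
    qed
    have "inv (t \<otimes> ?p) \<otimes> s \<otimes> (t \<otimes> ?p) = ?q \<otimes> (t \<otimes> s) \<otimes> (t \<otimes> ?p)"
      using s t by (simp add: invp inv inv_mult_group m_assoc)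
    also have "\<dots> = (t \<otimes> s) [^] Suc k \<otimes> (?q \<otimes> t)" by (simp add: flip)
    also have "\<dots> = (t \<otimes> s) [^] (Suc k + k) \<otimes> t"
      unfolding nat_pow_mult[OF m_closed[OF t(1) s(1)], symmetric] using s t by (simp add: m_assoc)
    finally have 2: "inv (t \<otimes> ?p) \<otimes> s \<otimes> (t \<otimes> ?p) = (t \<otimes> s) [^] Suc (2 * k) \<otimes> t"
      by (simp add: mult_2)
    show ?case using Suc 1 2 by (simp add: z zp)
  qed (simp add: z_def)
qed

text \<open>
  If \<open>(st)\<^sup>k = \<one>\<close>, then the \<open>2k\<close> palindromes \<open>(ts)\<^sup>j t\<close> depend only on \<open>j\<close> modulo \<open>k\<close>, so the list is the
  same list of length \<open>k\<close> twice. The order of \<open>st\<close> may be a proper divisor of \<open>k\<close> here.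
\<close>

lemma not_occurs_oddly_relator:
  assumes s: "s \<in> carrier G" "s \<otimes> s = \<one>" and t: "t \<in> carrier G" "t \<otimes> t = \<one>"
    and one: "list_product G (concat (replicate k [s, t])) = \<one>"
  shows "\<not> occurs_oddly (concat (replicate k [s, t])) x"
proof -
  define f where "f = (\<lambda>j :: nat. (t \<otimes> s) [^] j \<otimes> t)"
  have inv: "inv s = s" "inv t = t" using s t inv_equality by blast+
  have "(s \<otimes> t) [^] k = \<one>" using one inversion_list_dihedral(2)[OF s t] by simp
  moreover have "inv (s \<otimes> t) = t \<otimes> s" using s t inv by (simp add: inv_mult_group)
  ultimately have "(t \<otimes> s) [^] k = \<one>" using nat_pow_inv[of "s \<otimes> t" k] s t by simp
  then have "(t \<otimes> s) [^] (k + j) = (t \<otimes> s) [^] j" for j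
    unfolding nat_pow_mult[OF m_closed[OF t(1) s(1)], symmetric] using s t by simp
  then have period: "f (k + j) = f j" for j by (simp only: f_def)
  have "map f [k..<k + k] = map f [0..<k]"
    by (rule nth_equalityI) (simp_all add: period)
  then have "map f [0..<2 * k] = map f [0..<k] @ map f [0..<k]"
    using upt_add_eq_append[of 0 k k] by (simp add: mult_2)
  then have "inversion_list G (concat (replicate k [s, t])) = rev (map f [0..<k] @ map f [0..<k])"
    using inversion_list_dihedral(1)[OF s t, of k] by (simp only: f_def)
  then show ?thesis by simp
qed

end

section \<open>Inversions in a Coxeter group\<close>

locale coxeter = group W for W (structure) +
  fixes S
  assumes coxeter_system: "coxeter_system W S"

sublocale coxeter \<subseteq> involution_class W "reflections W S"
  using reflections_involution_class[OF coxeter_system] .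

context coxeter
begin

abbreviation "T \<equiv> reflections W S"
abbreviation "len \<equiv> word_length W S"
abbreviation "pr \<equiv> list_product W"

lemma S_carrier: "S \<subseteq> carrier W"
  using coxeter_system by (simp add: coxeter_system_def)

lemma S_closed [simp]: "s \<in> S \<Longrightarrow> s \<in> carrier W"
  using S_carrier by blast

lemma S_word_closed [simp]: "set xs \<subseteq> S \<Longrightarrow> set xs \<subseteq> carrier W"
  using S_carrier by blast

lemma S_involution: "s \<in> S \<Longrightarrow> s \<otimes> s = \<one>"
  using coxeter_system_involution[OF coxeter_system] .

lemma S_inv: "s \<in> S \<Longrightarrow> inv s = s"
  using S_involution inv_equality by simp

lemma T_inv: "t \<in> T \<Longrightarrow> inv t = t"
  by (rule inv_equality[OF T_involution]) simp_all

lemma S_subset_T: "S \<subseteq> T"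
proof
  fix s assume "s \<in> S"
  then show "s \<in> T" unfolding reflections_def by (intro CollectI exI[of _ \<one>] exI[of _ s]) simp
qed

lemma pr_rev: "set xs \<subseteq> S \<Longrightarrow> pr (rev xs) = inv (pr xs)"
  by (induction xs) (auto simp: list_product_append inv_mult_group S_inv)

text \<open>
  What the presentation says about words. The signs of the letters can be ignored since the generators
  are involutions.
\<close>

lemma word_equiv_iff_product:
  "\<exists>M. (\<forall>u\<in>signed_words S. \<forall>v\<in>signed_words S.
      word_equiv S (coxeter_relators S M) u v \<longleftrightarrow> pr (map fst u) = pr (map fst v)) \<and>
    (\<forall>w\<in>carrier W. \<exists>u\<in>signed_words S. pr (map fst u) = w)"
proof -
  obtain M \<phi> where
    \<phi>: "\<phi> \<in> iso (presented_group S (coxeter_relators S M)) W"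
      "\<forall>s\<in>S. \<phi> (word_class S (coxeter_relators S M) (positive_word [s])) = s"
    using coxeter_system unfolding coxeter_system_def by blast
  let ?R = "coxeter_relators S M"
  let ?P = "presented_group S ?R"
  let ?c = "word_class S ?R"
  interpret h: group_hom ?P W \<phi>
    using \<phi>(1) presented_group_is_group by (auto simp: group_hom_def group_hom_axioms_def iso_def)
  have carr: "?c u \<in> carrier ?P" if "u \<in> signed_words S" for u
    using that by (auto simp: presented_group_simps)
  have letter: "\<phi> (?c [(s, b)]) = s" if s: "s \<in> S" for s b
  proof (cases b)
    case True
    then show ?thesis using bspec[OF \<phi>(2) s] by (simp add: positive_word_def)
  next
    case False
    have w: "[(s, b)] \<in> signed_words S" "[(s, True)] \<in> signed_words S" using s by auto
    have "word_equiv S ?R ([] @ [(s, False), (s, \<not> False)] @ []) ([] @ [])"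
      using s by (intro word_cancel) auto
    then have "?c [(s, b)] \<otimes>\<^bsub>?P\<^esub> ?c [(s, True)] = \<one>\<^bsub>?P\<^esub>"
      using s False by (simp add: presented_group_mult presented_group_simps word_class_eq_iff)
    then have "\<phi> (?c [(s, b)]) \<otimes> \<phi> (?c [(s, True)]) = \<one>"
      using h.hom_mult[OF carr[OF w(1)] carr[OF w(2)]] h.hom_one by simp
    then have "\<phi> (?c [(s, b)]) \<otimes> s = \<one>" using bspec[OF \<phi>(2) s] by (simp add: positive_word_def)
    from inv_equality[OF this S_closed[OF s] h.hom_closed[OF carr[OF w(1)]]]
    show ?thesis using S_inv[OF s] by (rule trans[OF sym])
  qed
  have word_image: "\<phi> (?c u) = pr (map fst u)" if "u \<in> signed_words S" for u
    using that
  proof (induction u)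
    case Nil
    then show ?case using h.hom_one by (simp add: presented_group_simps)
  next
    case (Cons l u)
    obtain s b where l: "l = (s, b)" by (cases l)
    have w: "s \<in> S" "[(s, b)] \<in> signed_words S" "u \<in> signed_words S" using Cons l by auto
    have "?c (l # u) = ?c [(s, b)] \<otimes>\<^bsub>?P\<^esub> ?c u"
      using presented_group_mult[OF w(2,3), of ?R] l by simp
    then show ?case using h.hom_mult[OF carr[OF w(2)] carr[OF w(3)]] letter[OF w(1), of b] Cons.IH l
      by simp
  qed
  have bij: "bij_betw \<phi> (carrier ?P) (carrier W)" using \<phi>(1) unfolding iso_def by blast
  show ?thesis
  proof (intro exI[of _ M] conjI ballI)
    fix u v assume uv: "u \<in> signed_words S" "v \<in> signed_words S"
    have "word_equiv S ?R u v \<longleftrightarrow> ?c u = ?c v" using word_class_eq_iff[OF uv(1)] by blast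
    also have "\<dots> \<longleftrightarrow> \<phi> (?c u) = \<phi> (?c v)"
      using inj_on_eq_iff[OF bij_betw_imp_inj_on[OF bij] carr carr] uv by simp
    finally show "word_equiv S ?R u v \<longleftrightarrow> pr (map fst u) = pr (map fst v)"
      unfolding word_image[OF uv(1)] word_image[OF uv(2)] .
  next
    fix w assume "w \<in> carrier W"
    then have "w \<in> \<phi> ` ?c ` signed_words S"
      using bij_betw_imp_surj_on[OF bij] by (simp add: presented_group_simps)
    then obtain u where u: "u \<in> signed_words S" "w = \<phi> (?c u)" by blast
    have "pr (map fst u) = w" unfolding u(2) by (rule word_image[OF u(1), symmetric])
    then show "\<exists>u\<in>signed_words S. pr (map fst u) = w" using u(1) by (rule bexI)
  qed
qed

lemma S_generates: "w \<in> carrier W \<Longrightarrow> \<exists>xs. set xs \<subseteq> S \<and> pr xs = w"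
proof -
  assume "w \<in> carrier W"
  then obtain u where "u \<in> signed_words S" "pr (map fst u) = w" using word_equiv_iff_product by blast
  then show ?thesis by (intro exI[of _ "map fst u"]) force
qed

text \<open>
  Two words for the same element are connected by cancellations and relators, and in both \<open>xx\<close> and a
  relator every reflection occurs an even number of times.
\<close>

lemma occurs_oddly_well_defined:
  assumes "set xs \<subseteq> S" "set ys \<subseteq> S" "pr xs = pr ys" "t \<in> carrier W"
  shows "occurs_oddly xs t \<longleftrightarrow> occurs_oddly ys t"
proof -
  obtain M where M: "\<And>u v. u \<in> signed_words S \<Longrightarrow> v \<in> signed_words S \<Longrightarrow>
      word_equiv S (coxeter_relators S M) u v \<longleftrightarrow> pr (map fst u) = pr (map fst v)"
    using word_equiv_iff_product by blast
  have S: "set (map fst u) \<subseteq> S" if "u \<in> signed_words S" for u :: "'a signed_word" using that by force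
  have invariant: "occurs_oddly (map fst u) t \<longleftrightarrow> occurs_oddly (map fst v) t"
    if "word_equiv S (coxeter_relators S M) u v" for u v
    using that
  proof (induction rule: word_equiv.induct)
    case (word_cancel u v x b)
    have "\<not> occurs_oddly [x, x] t" for t
      using S_involution word_cancel(3) S_inv by (simp add: m_assoc)
    moreover have "pr [x, x] = \<one>" using S_involution word_cancel(3) by simp
    ultimately have "occurs_oddly (map fst u @ [x, x] @ map fst v) t \<longleftrightarrow>
        occurs_oddly (map fst u @ map fst v) t"
      using word_cancel(3) assms(4) S[OF word_cancel(1)] S[OF word_cancel(2)]
      by (intro occurs_oddly_insert) auto
    then show ?case by simp
  next
    case (word_relator u v r)
    obtain s s' k where r: "s \<in> S" "s' \<in> S" "r = positive_word (concat (replicate k [s, s']))"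
      using word_relator(4) by (auto simp: coxeter_relators_def)
    let ?r = "concat (replicate k [s, s'])"
    have fr: "map fst r = ?r" using r(3) by (simp add: positive_word_def comp_def)
    have "word_equiv S (coxeter_relators S M) ([] @ r @ []) ([] @ [])"
      using word_relator by (intro word_equiv.word_relator) auto
    then have "pr (map fst r) = \<one>" using M[OF word_relator(3), of "[]"] by simp
    then have one: "pr ?r = \<one>" using fr by simp
    have "occurs_oddly (map fst u @ ?r @ map fst v) t \<longleftrightarrow>
        occurs_oddly (map fst u @ map fst v) t"
    proof (rule occurs_oddly_insert[OF _ _ _ assms(4) one])
      show "\<not> occurs_oddly ?r x" for x
        using not_occurs_oddly_relator[OF _ _ _ _ one] r S_involution by simp
    qed (use r S[OF word_relator(1)] S[OF word_relator(2)] in auto)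
    then show ?case using fr by simp
  qed auto
  have "positive_word xs \<in> signed_words S" "positive_word ys \<in> signed_words S"
    using assms(1,2) by (auto simp: positive_word_def)
  moreover have "map fst (positive_word zs) = zs" for zs :: "'a list"
    by (simp add: positive_word_def comp_def)
  ultimately show ?thesis using invariant M assms(3) by metis
qed

lemma len_le: "set xs \<subseteq> S \<Longrightarrow> len (pr xs) \<le> length xs"
  unfolding word_length_def by (rule Least_le) blast

lemma reduced_word_exists:
  assumes "w \<in> carrier W"
  shows "\<exists>xs. set xs \<subseteq> S \<and> pr xs = w \<and> length xs = len w"
proof -
  have "\<exists>n xs. length xs = n \<and> set xs \<subseteq> S \<and> pr xs = w" using S_generates[OF assms] by blast
  from LeastI_ex[OF this] show ?thesis unfolding word_length_def by blast
qed

lemma delete_letter: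
  assumes "set (as @ s # bs) \<subseteq> S" "t = inv (pr bs) \<otimes> s \<otimes> pr bs"
  shows "pr (as @ s # bs) \<otimes> t = pr (as @ bs)"
  using assms S_involution by (simp add: list_product_append m_assoc mult_inv_cancel)
    (simp flip: m_assoc add: S_involution)

text \<open>
  Membership in the inversion set \<open>N(w)\<close>, as a parity. Which word is chosen for \<open>w\<close> does not matter by
  \<open>occurs_oddly_well_defined\<close>, and \<open>inversion_iff\<close> is the description by lengths.
\<close>

definition inversion :: "'a \<Rightarrow> 'a \<Rightarrow> bool" where
  "inversion w t \<longleftrightarrow> (\<exists>xs. set xs \<subseteq> S \<and> pr xs = w \<and> occurs_oddly xs t)"

lemma inversion_word:
  assumes "set xs \<subseteq> S" "t \<in> carrier W"
  shows "inversion (pr xs) t \<longleftrightarrow> occurs_oddly xs t"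
  using occurs_oddly_well_defined assms unfolding inversion_def by blast

lemma inversion_mult:
  assumes "x \<in> carrier W" "y \<in> carrier W" "t \<in> carrier W"
  shows "inversion (x \<otimes> y) t \<longleftrightarrow> (inversion x (y \<otimes> t \<otimes> inv y) \<noteq> inversion y t)"
proof -
  obtain xs ys where w: "set xs \<subseteq> S" "pr xs = x" "set ys \<subseteq> S" "pr ys = y"
    using S_generates assms by metis
  have "set (xs @ ys) \<subseteq> S" "pr (xs @ ys) = x \<otimes> y" using w by (auto simp: list_product_append)
  then have "inversion (x \<otimes> y) t \<longleftrightarrow> occurs_oddly (xs @ ys) t" using inversion_word assms by metis
  also have "\<dots> \<longleftrightarrow> (occurs_oddly xs (y \<otimes> t \<otimes> inv y) \<noteq> occurs_oddly ys t)"
    using occurs_oddly_append w assms by simp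
  finally show ?thesis using inversion_word w assms by (metis inv_closed m_closed)
qed

lemma inversion_one: "t \<in> carrier W \<Longrightarrow> \<not> inversion \<one> t"
  using inversion_word[of "[]" t] by simp

text \<open>
  Write \<open>t = w s w\<^sup>-\<^sup>1\<close> and apply the cocycle rule: the contributions of \<open>w\<close> and \<open>w\<^sup>-\<^sup>1\<close> agree, because
  \<open>w w\<^sup>-\<^sup>1 = \<one>\<close> has no inversions, so they cancel, and what is left is the middle letter \<open>s\<close>.
\<close>

lemma inversion_self:
  assumes "t \<in> T"
  shows "inversion t t"
proof -
  obtain w s where ws: "w \<in> carrier W" "s \<in> S" "t = w \<otimes> s \<otimes> inv w"
    using assms(1) unfolding reflections_def by blast
  have c: "s \<in> carrier W" "t \<in> carrier W" using ws by auto
  have s: "inversion s s" using inversion_word[of "[s]" s] ws(2) by simp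
  have wt: "inv w \<otimes> t \<otimes> w = s" using ws by (simp add: m_assoc inv_mult_cancel)
  have "inversion (w \<otimes> inv w) t \<longleftrightarrow> (inversion w s \<noteq> inversion (inv w) t)"
    using inversion_mult[of w "inv w" t] ws c wt by simp
  then have 1: "inversion w s \<longleftrightarrow> inversion (inv w) t" using inversion_one ws c by simp
  have 2: "inversion (s \<otimes> inv w) t \<longleftrightarrow> (inversion s s \<noteq> inversion (inv w) t)"
    using inversion_mult[of s "inv w" t] ws c wt by simp
  have "(s \<otimes> inv w) \<otimes> t \<otimes> inv (s \<otimes> inv w) = s \<otimes> (inv w \<otimes> t \<otimes> w) \<otimes> s"
    using ws c by (simp add: inv_mult_group m_assoc S_inv inv_mult_cancel)
  also have "\<dots> = s" using wt S_involution ws c by simp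
  finally have "inversion (w \<otimes> (s \<otimes> inv w)) t \<longleftrightarrow> (inversion w s \<noteq> inversion (s \<otimes> inv w) t)"
    using inversion_mult[of w "s \<otimes> inv w" t] ws c by simp
  moreover have "w \<otimes> (s \<otimes> inv w) = t" using ws c by (simp add: m_assoc)
  ultimately show ?thesis using 1 2 s by metis
qed

lemma inversion_mult_reflection:
  assumes "w \<in> carrier W" "t \<in> T"
  shows "inversion (w \<otimes> t) t \<longleftrightarrow> \<not> inversion w t"
proof -
  have "t \<otimes> t \<otimes> inv t = t" using assms by (simp add: m_assoc)
  then show ?thesis using inversion_mult[of w t t] inversion_self assms by simp
qed

text \<open>
  The strong exchange property. It holds for words that are not reduced, since an odd number of
  occurrences is not zero.
\<close>

lemma inversion_exchange:
  assumes "set xs \<subseteq> S" "t \<in> carrier W" "inversion (pr xs) t"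
  shows "\<exists>as s bs. xs = as @ s # bs \<and> t = inv (pr bs) \<otimes> s \<otimes> pr bs"
proof -
  have "count_list (inversion_list W xs) t \<noteq> 0"
    using assms inversion_word[OF assms(1,2)] by (auto simp: odd_pos)
  then have "t \<in> set (inversion_list W xs)" by (simp add: count_list_0_iff)
  then show ?thesis using inversion_list_member assms by simp
qed

lemma inversion_decreases:
  assumes "w \<in> carrier W" "t \<in> carrier W" "inversion w t"
  shows "len (w \<otimes> t) < len w"
proof -
  obtain xs where xs: "set xs \<subseteq> S" "pr xs = w" "length xs = len w"
    using reduced_word_exists assms by blast
  then obtain as s bs where d: "xs = as @ s # bs" "t = inv (pr bs) \<otimes> s \<otimes> pr bs"
    using inversion_exchange assms by blast
  then have "w \<otimes> t = pr (as @ bs)" using delete_letter xs by blast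
  moreover have "len (pr (as @ bs)) \<le> length (as @ bs)" using len_le[of "as @ bs"] d xs by auto
  ultimately show ?thesis using d xs by simp
qed

text \<open>
  Exactly one of \<open>w\<close> and \<open>wt\<close> has the inversion \<open>t\<close>, and the one that has it is the longer of the two.
\<close>

lemma inversion_iff:
  assumes "w \<in> carrier W" "t \<in> T"
  shows "inversion w t \<longleftrightarrow> len (w \<otimes> t) < len w"
proof
  assume "len (w \<otimes> t) < len w"
  show "inversion w t"
  proof (rule ccontr)
    assume "\<not> inversion w t"
    then have "inversion (w \<otimes> t) t" using inversion_mult_reflection[OF assms] by simp
    then have "len (w \<otimes> t \<otimes> t) < len (w \<otimes> t)" using inversion_decreases assms by simp
    then show False using \<open>len (w \<otimes> t) < len w\<close> assms T_involution by (simp add: m_assoc)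
  qed
qed (use assms inversion_decreases in simp)

lemma len_mult_noteq:
  assumes "w \<in> carrier W" "t \<in> T"
  shows "len (w \<otimes> t) \<noteq> len w"
proof (cases "inversion w t")
  case True
  then show ?thesis using inversion_decreases[of w t] assms by simp
next
  case False
  then have "inversion (w \<otimes> t) t" using inversion_mult_reflection[OF assms] by simp
  then have "len (w \<otimes> t \<otimes> t) < len (w \<otimes> t)" using inversion_decreases assms by simp
  then show ?thesis using assms T_involution by (simp add: m_assoc)
qed

text \<open>
  If deleting the letter \<open>s\<close> of \<open>as @ s # bs\<close> realizes \<open>t\<close>, then \<open>t\<close> has a palindromic word of length
  \<open>2 |bs| + 1\<close>, and since \<open>u\<close> is an involution, \<open>utu\<close> has one of length \<open>2 |as| + 1\<close>. If neither of them is shorter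
  than \<open>u\<close> itself, whose length is \<open>|as| + |bs| + 1\<close>, the letter must be the middle one.
\<close>

lemma middle_letter:
  assumes "u \<in> T" "t \<in> T" "inversion u t" "len u \<le> len t" "len u \<le> len (u \<otimes> t \<otimes> u)"
    and xs: "set xs \<subseteq> S" "pr xs = u" "length xs = len u"
  shows "\<exists>as s bs. xs = as @ s # bs \<and> length as = length bs \<and> t = inv (pr bs) \<otimes> s \<otimes> pr bs"
proof -
  obtain as s bs where d: "xs = as @ s # bs" "t = inv (pr bs) \<otimes> s \<otimes> pr bs"
    using inversion_exchange[OF xs(1), of t] xs assms by auto
  have S: "set as \<subseteq> S" "s \<in> S" "set bs \<subseteq> S" using d xs by auto
  have "pr (rev bs @ s # bs) = t" using S d by (simp add: list_product_append pr_rev m_assoc)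
  then have 1: "len t \<le> 2 * length bs + 1" using len_le[of "rev bs @ s # bs"] S by simp
  have "u \<otimes> t = pr (as @ bs)" using delete_letter xs d by blast
  moreover have "inv u = pr (rev bs) \<otimes> s \<otimes> pr (rev as)"
    using xs d S by (auto simp: list_product_append pr_rev inv_mult_group S_inv)
  ultimately have "u \<otimes> t \<otimes> u = pr as \<otimes> s \<otimes> pr (rev as)"
    using S T_inv[OF assms(1)] by (simp add: list_product_append pr_rev m_assoc mult_inv_cancel)
  then have "pr (as @ s # rev as) = u \<otimes> t \<otimes> u" using S by (simp add: list_product_append m_assoc)
  then have 2: "len (u \<otimes> t \<otimes> u) \<le> 2 * length as + 1" using len_le[of "as @ s # rev as"] S by simp
  have "length as = length bs" using 1 2 assms xs d by simp
  then show ?thesis using d by blast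
qed

text \<open>
  A reduced word has only one middle letter, and the inversion \<open>u\<close> of \<open>u\<close> deletes it already. So a
  reflection that has minimal length among the reflections of a reflection subgroup has no other
  inversion in that subgroup.
\<close>

lemma minimal_reflection_inversion:
  assumes "u \<in> T" "t \<in> T" "inversion u t" "len u \<le> len t" "len u \<le> len (u \<otimes> t \<otimes> u)"
  shows "t = u"
proof -
  obtain xs where xs: "set xs \<subseteq> S" "pr xs = u" "length xs = len u"
    using reduced_word_exists[OF T_closed[OF assms(1)]] by blast
  obtain as s bs where 1: "xs = as @ s # bs" "length as = length bs"
      "t = inv (pr bs) \<otimes> s \<otimes> pr bs"
    using middle_letter[OF assms xs] by blast
  have "u \<otimes> u \<otimes> u = u" using T_involution assms by simp
  then obtain as' s' bs' where 2: "xs = as' @ s' # bs'" "length as' = length bs'"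
      "u = inv (pr bs') \<otimes> s' \<otimes> pr bs'"
    using middle_letter[OF assms(1,1) inversion_self[OF assms(1)] _ _ xs] by auto
  have "length xs = Suc (2 * length as)" unfolding 1(1) using 1(2) by simp
  moreover have "length xs = Suc (2 * length as')" unfolding 2(1) using 2(2) by simp
  ultimately have "length as = length as'" by simp
  moreover have "as @ s # bs = as' @ s' # bs'" using 1(1) 2(1) by (rule trans[OF sym])
  ultimately have "s = s' \<and> bs = bs'" by simp
  then show ?thesis using 1(3) 2(3) by metis
qed

end

section \<open>The dihedral subgroup generated by two reflections\<close>

locale reflection_pair = coxeter +
  fixes p q
  assumes p: "p \<in> reflections W S" and q: "q \<in> reflections W S"
begin

abbreviation rotation :: "int \<Rightarrow> 'a" where "rotation k \<equiv> (p \<otimes> q) [^] k"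
text \<open>
  The reflections of the dihedral group, indexed by the integers so that \<open>p\<close> is \<open>reflection 0\<close> and \<open>q\<close>
  is \<open>reflection (- 1)\<close>. If \<open>pq\<close> has finite order, the indexing is periodic.
\<close>

definition reflection :: "int \<Rightarrow> 'a" where "reflection k = rotation k \<otimes> p"

lemma rotation_closed [simp]: "rotation k \<in> carrier W"
  using p q by simp

lemma reflection_closed [simp]: "reflection k \<in> carrier W"
  using p by (simp add: reflection_def)

lemma rotation_mult: "rotation i \<otimes> rotation j = rotation (i + j)"
  using p q by (simp add: int_pow_mult)

lemma rotation_values: "rotation 0 = \<one>" "rotation 1 = p \<otimes> q" "rotation (- 1) = q \<otimes> p"
  using p q T_inv by (simp_all add: int_pow_neg inv_mult_group)

lemma p_rotation: "p \<otimes> rotation k = rotation (- k) \<otimes> p"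
proof (induction k rule: int_induct[of _ 0])
  case base
  then show ?case using p by simp
next
  case (step1 i)
  have "p \<otimes> rotation (i + 1) = (p \<otimes> rotation i) \<otimes> rotation 1" using p by (simp add: m_assoc rotation_mult)
  also have "\<dots> = rotation (- i) \<otimes> (p \<otimes> rotation 1)" using p step1 by (simp add: m_assoc del: int_pow_1)
  also have "p \<otimes> rotation 1 = rotation (- 1) \<otimes> p"
    unfolding rotation_values using p q by (simp add: m_assoc T_cancel T_involution)
  also have "rotation (- i) \<otimes> (rotation (- 1) \<otimes> p) = rotation (- (i + 1)) \<otimes> p"
    using p by (simp add: rotation_mult flip: m_assoc)
  finally show ?case .
next
  case (step2 i)
  have "p \<otimes> rotation (i - 1) = (p \<otimes> rotation i) \<otimes> rotation (- 1)" using p by (simp add: m_assoc rotation_mult)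
  also have "\<dots> = rotation (- i) \<otimes> (p \<otimes> rotation (- 1))" using p step2 by (simp add: m_assoc)
  also have "p \<otimes> rotation (- 1) = rotation 1 \<otimes> p"
    unfolding rotation_values using p q by (simp add: m_assoc)
  also have "rotation (- i) \<otimes> (rotation 1 \<otimes> p) = rotation (- (i - 1)) \<otimes> p"
    using p rotation_mult[of "- i" 1] by (simp add: add.commute flip: m_assoc del: int_pow_1)
  finally show ?case .
qed

lemma rotation_reflection: "rotation i \<otimes> reflection j = reflection (i + j)"
  unfolding reflection_def using p by (simp add: rotation_mult flip: m_assoc)

lemma reflection_rotation: "reflection i \<otimes> rotation j = reflection (i - j)"
  unfolding reflection_def using p rotation_mult[of i "- j"] by (simp add: m_assoc p_rotation) (simp flip: m_assoc)

lemma reflection_reflection: "reflection i \<otimes> reflection j = rotation (i - j)"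
proof -
  have "reflection i \<otimes> reflection j = (reflection i \<otimes> rotation j) \<otimes> p" using p by (simp add: reflection_def m_assoc)
  then show ?thesis
    using p T_involution by (simp add: reflection_rotation) (simp add: reflection_def m_assoc)
qed

lemma reflection_conj: "reflection i \<otimes> reflection j \<otimes> reflection i = reflection (2 * i - j)"
  by (simp add: reflection_reflection rotation_reflection algebra_simps)

lemma reflection_values: "reflection 0 = p" "reflection (- 1) = q"
  using p q T_involution rotation_values by (simp_all add: reflection_def m_assoc)

lemma reflection_in_T: "reflection k \<in> T"
proof -
  have "reflection k \<in> T \<and> reflection (k - 1) \<in> T"
  proof (induction k rule: int_induct[of _ 0])
    case base
    then show ?case using p q reflection_values by simp
  next
    case (step1 i)
    then have "reflection i \<otimes> reflection (i - 1) \<otimes> reflection i \<in> T" using T_conj by blast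
    then show ?case using step1 by (simp add: reflection_conj)
  next
    case (step2 i)
    then have "reflection (i - 1) \<otimes> reflection i \<otimes> reflection (i - 1) \<in> T" using T_conj by blast
    then show ?case using step2 by (simp add: reflection_conj)
  qed
  then show ?thesis ..
qed

text \<open>
  Consecutive reflections have product \<open>pq\<close>, and one Hurwitz move shifts the index of such a pair by one
  in either direction. The moves lead towards \<open>(p, q)\<close>, which is the direction in which they are
  composed with other moves later on.
\<close>

lemma hurwitz_moves_reflection: "(hurwitz_move W)\<^sup>*\<^sup>* [reflection k, reflection (k - 1)] [p, q]"
proof (induction k rule: int_induct[of _ 0])
  case base
  then show ?case using reflection_values by simp
next
  case (step1 i)
  have "hurwitz_move W [reflection (i + 1), reflection i] [reflection i, reflection (i - 1)]"
    using hurwitz_move.move_right[of W "[]" "reflection (i + 1)" "reflection i" "[]"] by (simp add: reflection_conj)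
  then show ?case using step1 by (simp add: converse_rtranclp_into_rtranclp)
next
  case (step2 i)
  have "hurwitz_move W [reflection (i - 1), reflection (i - 1 - 1)] [reflection i, reflection (i - 1)]"
    using hurwitz_move.move_left[of W "[]" "reflection (i - 1)" "reflection (i - 1 - 1)" "[]"]
    by (simp add: reflection_conj)
  then show ?case using step2 by (simp add: converse_rtranclp_into_rtranclp)
qed

text \<open>
  Consider the coset of \<open>a\<close> modulo the dihedral group, and suppose that no \<open>a \<otimes> reflection k\<close> is shorter
  than the peak \<open>ap\<close>. Then the shortest element \<open>m\<close> of the coset has the form \<open>a \<otimes> rotation j\<close>, and it
  has no inversion in the dihedral group. Among the elements \<open>a \<otimes> rotation i\<close> it is the only such
  element: if \<open>x\<close> is one, let \<open>u\<close> be a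
  shortest reflection of the dihedral group, so that \<open>u\<close> is its own only inversion there. Then \<open>u\<close> is
  the only inversion of \<open>xu\<close> in the dihedral group. But \<open>xu = mv\<close> for a reflection \<open>v\<close>, and \<open>mv\<close> has the inversion \<open>v\<close>,
  whence \<open>u = v\<close> and \<open>x = m\<close>. Since \<open>p \<noteq> q\<close>, one of the neighbours \<open>a\<close> and \<open>apq\<close> of the peak is different
  from \<open>m\<close>; hence it has an inversion, and the element below it is shorter than the peak.
\<close>

lemma peak_lowering:
  assumes a: "a \<in> carrier W" and "p \<noteq> q"
    and up: "len a < len (a \<otimes> p)" and down: "len (a \<otimes> p \<otimes> q) < len (a \<otimes> p)"
  shows "\<exists>k. len (a \<otimes> reflection k) < len (a \<otimes> p)"
proof -
  obtain k0 where k0: "\<And>k. len (reflection k0) \<le> len (reflection k)"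
    using ex_has_least_nat[of "\<lambda>_. True" _ "\<lambda>k. len (reflection k)"] by blast
  define u where "u = reflection k0"
  have u: "u \<in> T" "u \<in> carrier W" "u \<otimes> u = \<one>" using reflection_in_T T_involution by (auto simp: u_def)
  have inv_u: "inversion u (reflection k) \<longleftrightarrow> reflection k = u" for k
    using minimal_reflection_inversion[of u "reflection k"] inversion_self u k0 reflection_in_T
    by (auto simp: u_def reflection_conj)
  show ?thesis
  proof (cases "\<exists>k. len (a \<otimes> reflection k) \<le> len a")
    case True
    then show ?thesis using up le_less_trans by blast
  next
    case False
    obtain j where j: "\<And>k. len (a \<otimes> rotation j) \<le> len (a \<otimes> rotation k)"
      using ex_has_least_nat[of "\<lambda>_. True" _ "\<lambda>k. len (a \<otimes> rotation k)"] by blast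
    define m where "m = a \<otimes> rotation j"
    have m: "m \<in> carrier W" using a by (simp add: m_def)
    have "len m \<le> len a" using j[of 0] a by (simp add: m_def)
    have mr: "m \<otimes> reflection k = a \<otimes> reflection (j + k)" for k using a by (simp add: m_def m_assoc rotation_reflection)
    have no_m: "\<not> inversion m (reflection k)" for k
    proof
      assume "inversion m (reflection k)"
      then have "len (a \<otimes> reflection (j + k)) < len m" using inversion_iff[OF m reflection_in_T, of k] mr by simp
      then have "len (a \<otimes> reflection (j + k)) \<le> len a" using \<open>len m \<le> len a\<close> by simp
      then show False using False by blast
    qed
    \<comment> \<open>\<open>i = 0\<close> and \<open>i = 1\<close> give the two neighbours \<open>a\<close> and \<open>apq\<close> of the peak.\<close>
    have "\<exists>i. a \<otimes> rotation i \<noteq> m \<and> len (a \<otimes> rotation i) < len (a \<otimes> p)"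
    proof (cases "a = m")
      case True
      have "a \<otimes> rotation 1 \<noteq> m"
      proof
        assume "a \<otimes> rotation 1 = m"
        then have "rotation 1 = \<one>" using True a by simp
        then have "inv q = p" unfolding rotation_values by (rule inv_equality) (use p q in simp_all)
        then show False using \<open>p \<noteq> q\<close> T_inv[OF q] by metis
      qed
      then show ?thesis using down a p q by (intro exI[of _ 1]) (simp add: m_assoc)
    next
      case False
      then show ?thesis using up a by (intro exI[of _ 0]) simp
    qed
    then obtain i where i: "a \<otimes> rotation i \<noteq> m" "len (a \<otimes> rotation i) < len (a \<otimes> p)" by blast
    define x where "x = a \<otimes> rotation i"
    have x: "x \<in> carrier W" using a by (simp add: x_def)
    have xr: "x \<otimes> reflection k = a \<otimes> reflection (i + k)" for k using a by (simp add: x_def m_assoc rotation_reflection)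
    have "\<exists>k. inversion x (reflection k)"
    proof (rule ccontr)
      assume no_x: "\<nexists>k. inversion x (reflection k)"
      define v where "v = reflection (i - j + k0)"
      have xu: "x \<otimes> u = m \<otimes> v" by (simp add: u_def v_def xr mr)
      have vc: "v \<in> T" "v \<in> carrier W" using reflection_in_T by (auto simp: v_def)
      have "u \<otimes> v \<otimes> inv u = reflection (2 * k0 - (i - j + k0))"
        using T_inv[OF u(1)] by (simp add: u_def v_def reflection_conj)
      then have "inversion (x \<otimes> u) v \<longleftrightarrow> inversion u v"
        using inversion_mult[OF x u(2) vc(2)] no_x by simp
      moreover have "inversion (m \<otimes> v) v"
        using inversion_mult_reflection[OF m vc(1)] no_m[of "i - j + k0"] by (simp add: v_def)
      ultimately have "inversion u v" using xu by simp
      then have "v = u" using inv_u[of "i - j + k0"] by (simp add: v_def)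
      then have "x = m" using xu x m u(2) by simp
      then show False using i by (simp add: x_def)
    qed
    then obtain k where "inversion x (reflection k)" by blast
    then have "len (a \<otimes> reflection (i + k)) < len x"
      using inversion_iff[OF x reflection_in_T] xr by simp
    then have "len (a \<otimes> reflection (i + k)) < len (a \<otimes> p)" using i(2) by (simp add: x_def)
    then show ?thesis by blast
  qed
qed

end

section \<open>Ascending factorizations\<close>

context coxeter
begin

text \<open>
  The sum of the lengths of all partial products, started at \<open>x\<close>. Replacing two adjacent factors by
  two others with the same product changes a single summand.
\<close>

primrec path_height :: "'a \<Rightarrow> 'a list \<Rightarrow> nat" where
  "path_height x [] = len x"
| "path_height x (t # ts) = len x + path_height (x \<otimes> t) ts"

lemma path_height_less:
  assumes "x \<in> carrier W" "set as \<subseteq> carrier W" "{a, b, a', b'} \<subseteq> carrier W"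
    and "a \<otimes> b = a' \<otimes> b'" "len (x \<otimes> pr as \<otimes> a') < len (x \<otimes> pr as \<otimes> a)"
  shows "path_height x (as @ a' # b' # bs) < path_height x (as @ a # b # bs)"
  using assms
proof (induction as arbitrary: x)
  case Nil
  have "x \<otimes> a \<otimes> b = x \<otimes> a' \<otimes> b'" using Nil by (simp add: m_assoc)
  then show ?case using Nil by simp
next
  case (Cons c as)
  then show ?case by (simp add: m_assoc)
qed

lemma hurwitz_move_invariants:
  assumes "hurwitz_move W xs ys" "set xs \<subseteq> T"
  shows "set ys \<subseteq> T" "length ys = length xs" "pr ys = pr xs"
proof -
  have c: "set zs \<subseteq> carrier W" if "set zs \<subseteq> T" for zs using that T_carrier by blast
  show "set ys \<subseteq> T" using assms T_conj by cases auto
  show "length ys = length xs" using assms by cases auto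
  show "pr ys = pr xs"
    using assms c by cases (auto simp: list_product_append m_assoc T_cancel T_involution)
qed

lemma hurwitz_moves_invariants:
  assumes "(hurwitz_move W)\<^sup>*\<^sup>* xs ys" "set xs \<subseteq> T"
  shows "set ys \<subseteq> T \<and> length ys = length xs \<and> pr ys = pr xs"
  using assms by (induction rule: rtranclp_induct) (use hurwitz_move_invariants in metis)+

definition ascending :: "'a list \<Rightarrow> bool" where
  "ascending ts \<longleftrightarrow> (\<forall>as t bs. ts = as @ t # bs \<longrightarrow> len (pr as) < len (pr (as @ [t])))"

lemma reduced_adjacent_noteq:
  assumes "reduced_factorization W T w (as @ p # q # bs)"
  shows "p \<noteq> q"
proof
  assume "p = q"
  have T: "set (as @ p # q # bs) \<subseteq> T" using assms by (simp add: reduced_factorization_def)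
  then have c: "set as \<subseteq> carrier W" "set bs \<subseteq> carrier W" using T_carrier by auto
  have "pr (as @ bs) = w"
    using assms \<open>p = q\<close> T c by (auto simp: reduced_factorization_def list_product_append T_cancel)
  then have "word_length W T w \<le> length (as @ bs)"
    unfolding word_length_def using T by (intro Least_le exI[of _ "as @ bs"]) auto
  then show False using assms by (simp add: reduced_factorization_def)
qed

text \<open>
  The tuple \<open>us\<close> is taken with minimal sum of the lengths of the partial products among the tuples from
  which Hurwitz moves lead to \<open>ts\<close>. By \<open>peak_lowering\<close> its partial products have no peak. The first step
  goes up because it starts at the identity, and after a step up the next one can only go up again.
\<close>

lemma ascending_representative:
  assumes "reduced_factorization W T w ts"
  shows "\<exists>us. set us \<subseteq> T \<and> (hurwitz_move W)\<^sup>*\<^sup>* us ts \<and> ascending us"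
proof -
  let ?P = "\<lambda>us. set us \<subseteq> T \<and> (hurwitz_move W)\<^sup>*\<^sup>* us ts"
  have "?P ts" using assms by (simp add: reduced_factorization_def)
  then obtain us where us: "?P us" and min: "\<And>vs. ?P vs \<Longrightarrow> path_height \<one> us \<le> path_height \<one> vs"
    using ex_has_least_nat[of ?P ts "path_height \<one>"] by blast
  have red: "reduced_factorization W T w us"
    using hurwitz_moves_invariants us assms by (auto simp: reduced_factorization_def)
  have no_peak: "len (pr (as @ [p])) \<le> len (pr (as @ [p, q]))"
    if d: "us = as @ p # q # bs" and up: "len (pr as) < len (pr (as @ [p]))" for as p q bs
  proof (rule ccontr)
    assume down: "\<not> len (pr (as @ [p])) \<le> len (pr (as @ [p, q]))"
    have T: "set as \<subseteq> T" "p \<in> T" "q \<in> T" "set bs \<subseteq> T" using us d by auto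
    have c: "set as \<subseteq> carrier W" using T T_carrier by blast
    interpret reflection_pair W S p q using T by unfold_locales
    have "p \<noteq> q" using reduced_adjacent_noteq red d by blast
    then obtain k where k: "len (pr as \<otimes> reflection k) < len (pr as \<otimes> p)"
      using peak_lowering[of "pr as"] up down c T by (auto simp: list_product_append m_assoc)
    let ?vs = "as @ reflection k # reflection (k - 1) # bs"
    have "(hurwitz_move W)\<^sup>*\<^sup>* (as @ [reflection k, reflection (k - 1)] @ bs) (as @ [p, q] @ bs)"
      using hurwitz_moves_context hurwitz_moves_reflection by blast
    then have "?P ?vs" using us d T reflection_in_T by auto
    moreover have "p \<otimes> q = reflection k \<otimes> reflection (k - 1)" using reflection_reflection rotation_values T by simp
    then have "path_height \<one> ?vs < path_height \<one> us"
      unfolding d using k c T by (intro path_height_less) auto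
    ultimately show False using min by (meson leD)
  qed
  have "len (pr as) < len (pr (as @ [t]))" if "us = as @ t # bs" for as t bs
    using that
  proof (induction as arbitrary: t bs rule: rev_induct)
    case Nil
    then have "t \<in> T" using us by auto
    moreover have "len \<one> = 0" using len_le[of "[]"] by simp
    ultimately show ?case using len_mult_noteq[of \<one> t] by simp
  next
    case (snoc p as)
    then have T: "set (as @ [p]) \<subseteq> T" "t \<in> T" using us by auto
    then have c: "set (as @ [p]) \<subseteq> carrier W" using T_carrier by blast
    have "len (pr as) < len (pr (as @ [p]))" using snoc.IH[of p "t # bs"] snoc.prems by simp
    then have "len (pr (as @ [p])) \<le> len (pr (as @ [p, t]))"
      using no_peak[of as p t bs] snoc.prems by simp
    moreover have "pr ((as @ [p]) @ [t]) = pr (as @ [p]) \<otimes> t"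
      using c T list_product_append[of "as @ [p]" "[t]"] by simp
    ultimately show ?case using len_mult_noteq[of "pr (as @ [p])" t] T c by simp
  qed
  then show ?thesis using us unfolding ascending_def by blast
qed

section \<open>Moving letters to the end of a word\<close>

text \<open>
  When the letter \<open>s\<close> passes a letter \<open>b\<close> on its right, \<open>b\<close> stays as it is and \<open>s\<close> gets conjugated by \<open>b\<close>.
\<close>

lemma hurwitz_moves_to_end:
  assumes "set bs \<subseteq> S" "s \<in> S"
  shows "(hurwitz_move W)\<^sup>*\<^sup>* (as @ s # bs) (as @ bs @ [inv (pr bs) \<otimes> s \<otimes> pr bs])"
proof -
  have "(hurwitz_move W)\<^sup>*\<^sup>* (t # bs) (bs @ [inv (pr bs) \<otimes> t \<otimes> pr bs])"
    if "set bs \<subseteq> S" "t \<in> carrier W" for t bs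
    using that
  proof (induction bs arbitrary: t)
    case Nil
    then show ?case by simp
  next
    case (Cons b bs)
    let ?t = "b \<otimes> t \<otimes> b"
    have "hurwitz_move W (t # b # bs) (b # ?t # bs)"
      using hurwitz_move.move_right[of W "[]" t b bs] by simp
    moreover have "(hurwitz_move W)\<^sup>*\<^sup>* ([b] @ (?t # bs) @ [])
        ([b] @ (bs @ [inv (pr bs) \<otimes> ?t \<otimes> pr bs]) @ [])"
      using Cons by (intro hurwitz_moves_context) auto
    moreover have "inv (pr bs) \<otimes> ?t \<otimes> pr bs = inv (pr (b # bs)) \<otimes> t \<otimes> pr (b # bs)"
      using Cons.prems by (simp add: inv_mult_group S_inv m_assoc)
    ultimately show ?case by (simp add: converse_rtranclp_into_rtranclp)
  qed
  from hurwitz_moves_context[OF this[of bs s], of as "[]"] show ?thesis using assms by simp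
qed

text \<open>
  The last factor \<open>t\<close> is an inversion of the product, so by exchange it is what one of the letters becomes
  on its way to the end. The remaining word need not be reduced even if \<open>ss\<close> is, which is why the
  induction runs over arbitrary words in the simple reflections.
\<close>

lemma hurwitz_moves_ascending:
  assumes "set ss \<subseteq> S" "set ts \<subseteq> T" "pr ss = pr ts" "ascending ts"
  shows "\<exists>qs. set qs \<subseteq> S \<and> (hurwitz_move W)\<^sup>*\<^sup>* ss (qs @ ts)"
  using assms
proof (induction ts arbitrary: ss rule: rev_induct)
  case Nil
  then show ?case by auto
next
  case (snoc t ts)
  have T: "t \<in> T" "set ts \<subseteq> T" using snoc by auto
  then have c: "set ts \<subseteq> carrier W" using T_carrier by blast
  have w: "pr ss = pr ts \<otimes> t" using snoc.prems(3) c T by (simp add: list_product_append)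
  then have wt: "pr ss \<otimes> t = pr ts" using c T T_involution by (simp add: m_assoc)
  have "len (pr ts) < len (pr (ts @ [t]))" using snoc.prems(4) by (auto simp: ascending_def)
  then have "len (pr ss \<otimes> t) < len (pr ss)" by (subst wt, subst snoc.prems(3))
  moreover have "pr ss \<in> carrier W" using snoc.prems(1) by simp
  ultimately have inv: "inversion (pr ss) t" using inversion_iff T(1) by blast
  then obtain as s bs where d: "ss = as @ s # bs" "t = inv (pr bs) \<otimes> s \<otimes> pr bs"
    using inversion_exchange[OF snoc.prems(1) T_closed[OF T(1)] inv] by blast
  have "pr (as @ bs) = pr ts" using delete_letter[of as s bs t] d snoc.prems(1) wt by simp
  moreover have "ascending ts" using snoc.prems(4) unfolding ascending_def
    by (metis append.assoc append_Cons)
  ultimately obtain qs where qs: "set qs \<subseteq> S" "(hurwitz_move W)\<^sup>*\<^sup>* (as @ bs) (qs @ ts)"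
    using snoc.IH[of "as @ bs"] T d snoc.prems(1) by auto
  have "(hurwitz_move W)\<^sup>*\<^sup>* ss (as @ bs @ [t])"
    using hurwitz_moves_to_end[of bs s as] d snoc.prems(1) by auto
  moreover have "(hurwitz_move W)\<^sup>*\<^sup>* (as @ bs @ [t]) (qs @ ts @ [t])"
    using hurwitz_moves_context[OF qs(2), of "[]" "[t]"] by simp
  ultimately show ?case using qs(1) by (meson rtranclp_trans)
qed

lemma hurwitz_move_letter:
  assumes "hurwitz_move W xs ys"
  shows "\<exists>l\<in>{1..<length xs} \<times> UNIV. hurwitz_letter W l xs = ys"
  using assms
proof cases
  case (move_right as a b bs)
  then show ?thesis
    by (intro bexI[of _ "(Suc (length as), False)"])
      (auto simp: list_update_append nth_append)
next
  case (move_left as a b bs)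
  then show ?thesis
    by (intro bexI[of _ "(Suc (length as), True)"])
      (auto simp: list_update_append nth_append)
qed

text \<open>
  A word in the braid generators acts from its last letter to its first, so every further move is
  prepended.
\<close>

lemma hurwitz_moves_braid:
  assumes "(hurwitz_move W)\<^sup>*\<^sup>* xs ys" "set xs \<subseteq> T"
  shows "\<exists>\<sigma>\<in>carrier (braid_group (length xs)). hurwitz W \<sigma> xs = ys"
proof -
  have "\<exists>u\<in>signed_words {1..<length xs}. hurwitz_word W u xs = ys"
    using assms(1)
  proof (induction rule: rtranclp_induct)
    case base
    show ?case by (intro bexI[of _ "[]"]) (auto simp: hurwitz_word_def)
  next
    case (step ys zs)
    then obtain u where u: "u \<in> signed_words {1..<length xs}" "hurwitz_word W u xs = ys" by blast
    have "length ys = length xs" using hurwitz_moves_invariants step assms(2) by blast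
    then obtain l where "l \<in> {1..<length xs} \<times> UNIV" "hurwitz_letter W l ys = zs"
      using hurwitz_move_letter step by metis
    then show ?case using u by (intro bexI[of _ "l # u"]) (auto simp: hurwitz_word_def)
  qed
  then obtain u where u: "u \<in> signed_words {1..<length xs}" "hurwitz_word W u xs = ys" by blast
  let ?\<sigma> = "word_class {1..<length xs} (braid_relators (length xs)) u"
  have "?\<sigma> \<in> carrier (braid_group (length xs))"
    using u by (auto simp: braid_group_def presented_group_simps)
  moreover have "hurwitz W ?\<sigma> xs = ys"
    using hurwitz_class[of xs "length xs" u] u assms by (simp add: tuples_def)
  ultimately show ?thesis by blast
qed

end

text \<open>
  Hurwitz moves lead from \<open>ss\<close> to an ascending tuple \<open>us\<close> preceded by simple reflections, and then from
  \<open>us\<close> to \<open>ts\<close> behind these. They preserve the length of the tuple, which fixes the number of simple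
  reflections in front.
\<close>

theorem theorem1p2:
  fixes W :: "('a, 'b) monoid_scheme" and S :: "'a set" and w :: 'a
    and m n :: nat and ss ts :: "'a list"
  assumes "coxeter_system W S" and "finite S"
    and "w \<in> carrier W"
    and "reduced_factorization W S w ss" and "length ss = m"
    and "reduced_factorization W (reflections W S) w ts" and "length ts = n"
  shows "\<exists>qs. length qs = m - n \<and> set qs \<subseteq> S \<and>
    (\<exists>\<sigma> \<in> carrier (braid_group m). hurwitz W \<sigma> ss = qs @ ts)"
proof -
  interpret coxeter W S
    using assms(1) by (simp add: coxeter_def coxeter_axioms_def coxeter_system_def)
  have ss: "set ss \<subseteq> S" "pr ss = w" using assms by (auto simp: reduced_factorization_def)
  obtain us where us: "set us \<subseteq> T" "(hurwitz_move W)\<^sup>*\<^sup>* us ts" "ascending us"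
    using ascending_representative assms by blast
  have "pr us = w"
    using hurwitz_moves_invariants us assms by (simp add: reduced_factorization_def)
  then obtain qs where qs: "set qs \<subseteq> S" "(hurwitz_move W)\<^sup>*\<^sup>* ss (qs @ us)"
    using hurwitz_moves_ascending ss us by metis
  have "(hurwitz_move W)\<^sup>*\<^sup>* (qs @ us) (qs @ ts)"
    using hurwitz_moves_context[OF us(2), of qs "[]"] by simp
  then have moves: "(hurwitz_move W)\<^sup>*\<^sup>* ss (qs @ ts)" using qs(2) by simp
  have ssT: "set ss \<subseteq> T" using ss S_subset_T by blast
  have "length qs = m - n" using hurwitz_moves_invariants[OF moves ssT] assms(5,7) by auto
  then show ?thesis using hurwitz_moves_braid[OF moves ssT] qs(1) assms(5) by blast
qed

end
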